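(* There is an absolute constant $c>0$ such that for any positive integer $N$ the set $$\{n^3 : n\in\mathbb{N},\ N\le n \le N+cN^{2/3}\}$$ is not a Sidon set.
   Context: $\mathbb{N}$ denotes the positive integers. A set $\mathcal{A}$ of integers is called a Sidon set if the equation $a_1+a_2=a_3+a_4$ with $a_1,a_2,a_3,a_4\in\mathcal{A}$ has only trivial solutions, i.e. every solution satisfies $\{a_1,a_2\}=\{a_3,a_4\}$. *)

theory Defs
  imports Complex_Main
begin

definition sidon_set :: "int set \<Rightarrow> bool" where
  "sidon_set A \<longleftrightarrow>
     (\<forall>a1\<in>A. \<forall>a2\<in>A. \<forall>a3\<in>A. \<forall>a4\<in>A.
        a1 + a2 = a3 + a4 \<longrightarrow> {a1, a2} = {a3, a4})"

end

theory Submission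
  imports Defs
begin

text \<open>
  The equation \<open>x\<^sup>3 + y\<^sup>3 = u\<^sup>3 + v\<^sup>3\<close> has a one-parameter family of solutions in which all four
  unknowns are cubic polynomials in \<open>k\<close> with the same leading term \<open>k\<^sup>3\<close>. The four values at \<open>k\<close>
  therefore lie within \<open>O(k\<^sup>2)\<close> of \<open>k\<^sup>3\<close>, and consecutive cubes \<open>k\<^sup>3\<close> are also only \<open>O(k\<^sup>2)\<close> apart.
  Hence some \<open>k\<close> slightly above the cube root of \<open>N\<close> places all four values in an interval of
  length \<open>O(N\<^bsup>2/3\<^esup>)\<close> to the right of \<open>N\<close>.
\<close>

text \<open>
  This is a specialisation of Euler's parametrisation, which for rational \<open>a\<close>, \<open>b\<close> and
  \<open>n = a\<^sup>2 + 3 b\<^sup>2\<close> makes \<open>x, y, u, v\<close> proportional to \<open>1 - (a - 3 b) n\<close>, \<open>(a + 3 b) n - 1\<close>,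
  \<open>(a + 3 b) - n\<^sup>2\<close>, \<open>n\<^sup>2 - (a - 3 b)\<close>. Taking \<open>a = 1\<close> and \<open>b = 1/k\<close> with scaling factor \<open>k\<^sup>4/3\<close> cancels
  the terms in \<open>k\<^sup>4\<close> and leaves the leading term \<open>k\<^sup>3\<close> in each of them.
\<close>

lemma equal_sums_of_nearby_cubes:
  fixes k :: "'a::comm_ring_1"
  shows "(k^3 - k^2 + 3*k)^3 + (k^3 + k^2 + 3*k)^3 =
         (k^3 - 2*k^2 - 3)^3 + (k^3 + 2*k^2 + 3)^3"
  by (simp add: power2_eq_square power3_eq_cube algebra_simps)

lemma not_sidon_set_cubes:
  assumes "u \<in> S" "v \<in> S" "x \<in> S" "y \<in> S"
    and eq: "x^3 + y^3 = u^3 + v^3" and "u \<noteq> x" "u \<noteq> y"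
  shows "\<not> sidon_set ((\<lambda>n::nat. int n ^ 3) ` S)"
proof
  assume "sidon_set ((\<lambda>n. int n ^ 3) ` S)"
  moreover have "int x ^ 3 + int y ^ 3 = int u ^ 3 + int v ^ 3"
    using eq by (metis of_nat_add of_nat_power)
  ultimately have "{int x ^ 3, int y ^ 3} = {int u ^ 3, int v ^ 3}"
    using assms(1-4) unfolding sidon_set_def by blast
  then have "int u ^ 3 = int x ^ 3 \<or> int u ^ 3 = int y ^ 3"
    by blast
  then show False
    using \<open>u \<noteq> x\<close> \<open>u \<noteq> y\<close> by (auto dest: power_eq_imp_eq_base)
qed

theorem theorem4:
  shows "\<exists>c::real. c > 0 \<and>
    (\<forall>N::nat. N > 0 \<longrightarrow>
      \<not> sidon_set {int n ^ 3 | n::nat. n > 0 \<and> N \<le> n \<and>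
          real n \<le> real N + c * real N powr (2 / 3)})"
proof (intro exI[of _ 177] conjI allI impI)
  fix N :: nat
  assume "N > 0"
  define r where "r = real N powr (1/3)"
  have "r \<ge> 1"
    using \<open>N > 0\<close> by (simp add: r_def ge_one_powr_ge_zero)
  have r3: "r^3 = real N" and r2: "r^2 = real N powr (2/3)"
    using \<open>N > 0\<close> by (simp_all add: r_def powr_power)
  define p where "p = nat \<lceil>r\<rceil>"
  have p: "r \<le> real p" "real p \<le> r + 1"
    using \<open>r \<ge> 1\<close> unfolding p_def by linarith+
  \<comment> \<open>The four polynomials at \<open>k = p + 3\<close>. The shift by 3 makes all coefficients nonnegative, so that
      even the smallest of them is at least \<open>p\<^sup>3 \<ge> N\<close>.\<close>
  define u where "u = p^3 + 7*p^2 + 15*p + 6"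
  define x where "x = p^3 + 8*p^2 + 24*p + 27"
  define y where "y = p^3 + 10*p^2 + 36*p + 45"
  define v where "v = p^3 + 11*p^2 + 39*p + 48"
  define S where "S = {n::nat. n > 0 \<and> N \<le> n \<and> real n \<le> real N + 177 * real N powr (2/3)}"
  have "int x ^ 3 + int y ^ 3 = int u ^ 3 + int v ^ 3"
  proof -
    have "int x = (int p + 3)^3 - (int p + 3)^2 + 3*(int p + 3)"
      "int y = (int p + 3)^3 + (int p + 3)^2 + 3*(int p + 3)"
      "int u = (int p + 3)^3 - 2*(int p + 3)^2 - 3"
      "int v = (int p + 3)^3 + 2*(int p + 3)^2 + 3"
      by (simp_all add: x_def y_def u_def v_def power2_eq_square power3_eq_cube algebra_simps)
    then show ?thesis
      using equal_sums_of_nearby_cubes[of "int p + 3"] by simp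
  qed
  then have eq: "x^3 + y^3 = u^3 + v^3"
    by (metis of_nat_add of_nat_eq_iff of_nat_power)
  have "real N \<le> real p ^ 3"
    using power_mono[OF p(1), of 3] \<open>r \<ge> 1\<close> r3 by simp
  then have "N \<le> p^3"
    by (metis of_nat_le_iff of_nat_power)
  then have "N \<le> u"
    by (simp add: u_def)
  have "real v = real p ^ 3 + 11 * real p ^ 2 + 39 * real p + 48"
    by (simp add: v_def)
  also have "\<dots> \<le> (r+1)^3 + 11 * (r+1)^2 + 39 * (r+1) + 48"
    using p by (intro add_mono mult_left_mono power_mono) auto
  also have "\<dots> = r^3 + 14 * r^2 + 64 * r + 99"
    by (simp add: power2_eq_square power3_eq_cube algebra_simps)
  also have "\<dots> \<le> r^3 + 177 * r^2"
  proof -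
    have "r \<le> r^2"
      using \<open>r \<ge> 1\<close> by (simp add: self_le_power)
    then show ?thesis
      using \<open>r \<ge> 1\<close> by linarith
  qed
  finally have v: "real v \<le> real N + 177 * real N powr (2/3)"
    by (simp add: r2 r3)
  have order: "u < x" "x < y" "y < v"
    by (simp_all add: u_def x_def y_def v_def)
  have "n \<in> S" if "u \<le> n" "n \<le> v" for n
  proof -
    have "real n \<le> real v" "u > 0"
      using that by (simp_all add: u_def)
    then show ?thesis
      unfolding S_def using that v \<open>N \<le> u\<close> by auto
  qed
  then have "u \<in> S" "v \<in> S" "x \<in> S" "y \<in> S"
    using order by simp_all
  then have "\<not> sidon_set ((\<lambda>n. int n ^ 3) ` S)"
    using eq order by (intro not_sidon_set_cubes[of u S v x y]) auto
  moreover have "(\<lambda>n. int n ^ 3) ` S = {int n ^ 3 | n::nat. n > 0 \<and> N \<le> n \<and>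
      real n \<le> real N + 177 * real N powr (2 / 3)}"
    unfolding S_def by (rule image_Collect)
  ultimately show "\<not> sidon_set {int n ^ 3 | n::nat. n > 0 \<and> N \<le> n \<and>
      real n \<le> real N + 177 * real N powr (2 / 3)}"
    by simp
qed simp

end
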